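(* Let $\mathfrak{B}_1,\mathfrak{B}_2\in\mathfrak{L}^{\mathtt w}$ with at least one of them uncontrollable, and let $\Sigma\in\mathbb{R}^{\mathtt w\times\mathtt w}$ be nonsingular. If $\mathfrak{B}_1\perp_\Sigma\mathfrak{B}_2$, then $\mathtt m(\mathfrak{B}_1)+\mathtt m(\mathfrak{B}_2)<\mathtt w$.
   Context: A linear differential behavior with $\mathtt w$ variables is a set $\mathfrak{B}=\{w\in C^\infty(\mathbb{R},\mathbb{R}^{\mathtt w}) : R(\frac{d}{dt})w=0\}$ for some polynomial matrix $R(\xi)$ with real coefficients and $\mathtt w$ columns. $\mathfrak{L}^{\mathtt w}$ is the set of all such behaviors. The input cardinality is $\mathtt m(\mathfrak{B}):=\mathtt w-\operatorname{rank}R$ (rank as a polynomial matrix); it does not depend on the choice of $R$. $\mathfrak{B}$ is controllable if for all $w_1,w_2\in\mathfrak{B}$ there exist $w_3\in\mathfrak{B}$ and $\tau>0$ with $w_3(t)=w_1(t)$ for $t\le 0$ and $w_3(t)=w_2(t)$ for $t\ge\tau$; otherwise it is uncontrollable. $\mathfrak{L}^{\mathtt w}_{cont}$ is the set of controllable behaviors in $\mathfrak{L}^{\mathtt w}$, and $\mathfrak{D}$ is the set of compactly supported functions in $C^\infty(\mathbb{R},\mathbb{R}^{\mathtt w})$. Definition of orthogonality: for nonsingular $\Sigma\in\mathbb{R}^{\mathtt w\times\mathtt w}$, $\mathfrak{B}_1,\mathfrak{B}_2\in\mathfrak{L}^{\mathtt w}$ are $\Sigma$-orthogonal, written $\mathfrak{B}_1\perp_\Sigma\mathfrak{B}_2$,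 if there exist $\mathfrak{B}_1^c,\mathfrak{B}_2^c\in\mathfrak{L}^{\mathtt w}_{cont}$ such that $\mathfrak{B}_1\subseteq\mathfrak{B}_1^c$, $\mathfrak{B}_2\subseteq\mathfrak{B}_2^c$, and $\int_{\mathbb{R}}w_1^T\Sigma w_2\,dt=0$ for all $w_1\in\mathfrak{B}_1^c\cap\mathfrak{D}$ and all $w_2\in\mathfrak{B}_2^c\cap\mathfrak{D}$. *)

theory Defs
  imports
    "HOL-Analysis.Analysis"
    "HOL-Computational_Algebra.Polynomial"
    "HOL-Computational_Algebra.Fraction_Field"
begin

definition nth_vderiv :: "nat \<Rightarrow> (real \<Rightarrow> 'a::real_normed_vector) \<Rightarrow> real \<Rightarrow> 'a" where
  "nth_vderiv k w = ((\<lambda>f t. vector_derivative f (at t)) ^^ k) w"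

definition C_infinity :: "(real \<Rightarrow> 'a::real_normed_vector) set" where
  "C_infinity = {w. \<forall>k t. nth_vderiv k w differentiable (at t)}"

text \<open>A polynomial matrix is given by the list of its rows, so that the number of rows (possibly 0)
  can be quantified over.\<close>

type_synonym 'w poly_matrix = "(real poly ^ 'w) list"

text \<open>The scalar function \<open>r(d/dt) w\<close>, for a polynomial row vector \<open>r\<close>.\<close>

definition diff_op :: "real poly ^ 'w::finite \<Rightarrow> (real \<Rightarrow> real ^ 'w) \<Rightarrow> real \<Rightarrow> real" where
  "diff_op r w t = (\<Sum>j\<in>UNIV. \<Sum>k\<le>degree (r $ j). coeff (r $ j) k * (nth_vderiv k w t $ j))"

definition kernel_behavior :: "'w::finite poly_matrix \<Rightarrow> (real \<Rightarrow> real ^ 'w) set" where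
  "kernel_behavior R = {w \<in> C_infinity. \<forall>r\<in>set R. \<forall>t. diff_op r w t = 0}"

definition behaviors :: "(real \<Rightarrow> real ^ 'w::finite) set set" where
  "behaviors = range kernel_behavior"

text \<open>The rank of a polynomial matrix is its (row) rank over the field of rational functions;
  compare \<open>row_rank_def_gen\<close>.\<close>

definition poly_matrix_rank :: "'w::finite poly_matrix \<Rightarrow> nat" where
  "poly_matrix_rank R = vec.dim ((\<lambda>r. \<chi> j. Fract (r $ j) 1) ` set R)"

text \<open>The value does not depend on which kernel representation is selected. The subtraction never
  truncates, since the rank is at most the number of columns.\<close>

definition input_card :: "(real \<Rightarrow> real ^ 'w::finite) set \<Rightarrow> nat" where
  "input_card B = CARD('w) - poly_matrix_rank (SOME R. B = kernel_behavior R)"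

definition controllable :: "(real \<Rightarrow> real ^ 'w::finite) set \<Rightarrow> bool" where
  "controllable B \<longleftrightarrow>
    (\<forall>w1\<in>B. \<forall>w2\<in>B. \<exists>w3\<in>B. \<exists>\<tau>>0. (\<forall>t\<le>0. w3 t = w1 t) \<and> (\<forall>t\<ge>\<tau>. w3 t = w2 t))"

definition controllable_behaviors :: "(real \<Rightarrow> real ^ 'w::finite) set set" where
  "controllable_behaviors = {B \<in> behaviors. controllable B}"

definition test_functions :: "(real \<Rightarrow> real ^ 'w::finite) set" where
  "test_functions = {w \<in> C_infinity. compact (closure {t. w t \<noteq> 0})}"

definition orthogonal_behaviors ::
  "real ^ 'w ^ 'w \<Rightarrow> (real \<Rightarrow> real ^ 'w) set \<Rightarrow> (real \<Rightarrow> real ^ 'w) set \<Rightarrow> bool" where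
  "orthogonal_behaviors \<Sigma> B1 B2 \<longleftrightarrow>
    (\<exists>B1c\<in>controllable_behaviors. \<exists>B2c\<in>controllable_behaviors. B1 \<subseteq> B1c \<and> B2 \<subseteq> B2c \<and>
      (\<forall>w1\<in>B1c \<inter> test_functions. \<forall>w2\<in>B2c \<inter> test_functions.
        integral UNIV (\<lambda>t. w1 t \<bullet> (\<Sigma> *v w2 t)) = 0))"

end

theory Submission
  imports Defs
begin

text \<open>
  The input cardinality of \<open>ker R(d/dt)\<close> is the dimension, over the rational functions, of the space
  of polynomial vectors \<open>p\<close> with \<open>R p = 0\<close>; these are exactly the \<open>p\<close> for which every signal
  \<open>p(d/dt) f\<close> lies in the behavior, so the input cardinality is monotone in the behavior.

  If \<open>B \<subseteq> C\<close> have equal input cardinality, the two representations have the same row space, so on \<open>C\<close>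
  every equation of \<open>B\<close> holds after applying a nonzero scalar differential operator. If \<open>C\<close> is
  controllable, each of its signals can be reached from rest, and uniqueness for scalar differential
  equations then gives \<open>B = C\<close>. Hence the input cardinality strictly increases from an uncontrollable
  behavior to a controllable one containing it.

  For the two controllable behaviors witnessing orthogonality, integration by parts turns the
  hypothesis into \<open>p(-\<xi>)\<^sup>T \<Sigma> q(\<xi>) = 0\<close> for all \<open>p\<close>, \<open>q\<close> in the respective spaces, so the dimensions of
  these spaces add up to at most the number of variables.
\<close>

subsection \<open>Annihilators of polynomial vectors\<close>

text \<open>The ring is left general: over \<open>real poly\<close> this is the right kernel of the
  polynomial matrix with rows \<open>S\<close>, over a field it is the space in the rank-nullity
  count.\<close>

definition annihilator :: "('a::comm_ring_1 ^ 'n::finite) set \<Rightarrow> ('a ^ 'n) set" where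
  "annihilator S = {p. \<forall>r\<in>S. (\<Sum>j\<in>UNIV. r $ j * p $ j) = 0}"

text \<open>Rank-nullity: a basis \<open>B\<close> of the span of \<open>S\<close> is completed to a
  basis of the whole space, which supplies the rows of an invertible matrix \<open>M\<close>. In the
  coordinates \<open>M *v x\<close>, the annihilator is the coordinate subspace where the entries
  belonging to \<open>B\<close> vanish.\<close>

lemma dim_add_dim_annihilator:
  fixes S :: "('a::field ^ 'n::finite) set"
  shows "vec.dim S + vec.dim (annihilator S) = CARD('n)"
proof -
  let ?N = "{x::'a^'n. \<forall>s\<in>S. (\<Sum>j\<in>UNIV. s $ j * x $ j) = 0}"
  obtain B where B: "B \<subseteq> S" "vec.independent B" "S \<subseteq> vec.span B" "card B = vec.dim S"
    using vec.basis_exists[of S] by blast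
  define C where "C = vec.extend_basis B"
  have C: "vec.independent C" "vec.span C = UNIV" "B \<subseteq> C"
    using B(2) vec.independent_extend_basis vec.span_extend_basis vec.extend_basis_superset
    unfolding C_def by blast+
  have fC: "finite C" using C(1) vec.finiteI_independent by blast
  have "card C = vec.dim (UNIV :: ('a^'n) set)"
    using vec.basis_card_eq_dim[of C UNIV] C by auto
  then have cardC: "card C = CARD('n)" by (simp only: vec_dim_card)
  obtain b where b: "bij_betw b (UNIV :: 'n set) C"
    using finite_same_card_bij[of "UNIV :: 'n set" C] fC cardC by auto
  define M :: "'a^'n^'n" where "M = (\<chi> i. b i)"
  have "rows M = C"
    using b by (auto simp: rows_def row_def M_def bij_betw_def vec_lambda_eta)
  then have "\<exists>M'. M' ** M = mat 1"
    using C(2) matrix_left_invertible_span_rows_gen[of M] by simp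
  then have inj: "inj ((*v) M)"
    using matrix_left_invertible_injective by blast
  then have surj: "surj ((*v) M)"
    by (intro vec.linear_inj_imp_surj matrix_vector_mul_linear_gen)
  define I where "I = b -` B"
  have cardI: "card I = card B"
    using b C(3) card_vimage_inj[of b B] by (auto simp: I_def bij_betw_def)
  have "?N = {x. \<forall>s\<in>B. (\<Sum>j\<in>UNIV. s $ j * x $ j) = 0}"
  proof (intro equalityI subsetI CollectI ballI)
    fix x s assume x: "x \<in> {x. \<forall>s\<in>B. (\<Sum>j\<in>UNIV. s $ j * x $ j) = 0}" and s: "s \<in> S"
    \<comment> \<open>For fixed \<open>x\<close> the condition is linear in \<open>s\<close>, so it
      passes from \<open>B\<close> to its span, hence to \<open>S\<close>.\<close>
    have "vec.subspace {s. (\<Sum>j\<in>UNIV. s $ j * x $ j) = 0}"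
      by (auto simp: vec.subspace_def algebra_simps sum.distrib simp flip: sum_distrib_left)
    then have "vec.span B \<subseteq> {s. (\<Sum>j\<in>UNIV. s $ j * x $ j) = 0}"
      using x by (intro vec.span_minimal) auto
    then show "(\<Sum>j\<in>UNIV. s $ j * x $ j) = 0" using s B(3) by auto
  qed (use B(1) in auto)
  also have "\<dots> = {x. \<forall>i\<in>I. (M *v x) $ i = 0}"
    using b C(3) unfolding I_def M_def bij_betw_def matrix_vector_mult_def by auto
  finally have N: "?N = {x. \<forall>i\<in>I. (M *v x) $ i = 0}" .
  have "(*v) M ` ?N = {y. \<forall>i. i \<notin> - I \<longrightarrow> y $ i = 0}"
    unfolding N
  proof (intro equalityI subsetI)
    fix y :: "'a ^ 'n" assume y: "y \<in> {y. \<forall>i. i \<notin> - I \<longrightarrow> y $ i = 0}"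
    obtain x where "y = M *v x" using surj by auto
    then show "y \<in> (*v) M ` {x. \<forall>i\<in>I. (M *v x) $ i = 0}" using y by auto
  qed auto
  then have "vec.dim ((*v) M ` ?N) = card (- I)"
    by (simp only: dim_substandard_cart)
  then have "vec.dim ?N = card (- I)"
    using vec.dim_image_eq[OF matrix_vector_mul_linear_gen[of M], of ?N] inj
    by (simp add: inj_on_subset[OF inj])
  moreover have "card I + card (- I) = CARD('n)"
    using card_Un_disjoint[of I "- I"] by simp
  ultimately show ?thesis using cardI B(4) by (simp add: annihilator_def)
qed

section \<open>Passage from an integral domain to its fraction field\<close>

abbreviation fract_vec :: "'a::idom ^ 'n \<Rightarrow> 'a fract ^ 'n" where
  "fract_vec p \<equiv> \<chi> j. Fract (p $ j) 1"

lemma Fract_1_eq_iff [simp]: "Fract a 1 = Fract b 1 \<longleftrightarrow> a = b"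
  by (simp add: eq_fract)

lemma Fract_1_eq_0_iff [simp]: "Fract a 1 = 0 \<longleftrightarrow> a = 0"
  by (simp add: Zero_fract_def)

lemma sum_Fract_1: "(\<Sum>i\<in>A. Fract (f i) 1) = Fract (sum f A) 1"
  by (induction A rule: infinite_finite_induct) (auto simp: Zero_fract_def)

lemma fract_vec_eq_iff: "fract_vec p = fract_vec q \<longleftrightarrow> p = q"
  by (auto simp: vec_eq_iff)

lemma common_denominator:
  fixes c :: "'b \<Rightarrow> 'a::idom fract"
  assumes "finite A"
  shows "\<exists>d a. d \<noteq> 0 \<and> (\<forall>q\<in>A. Fract d 1 * c q = Fract (a q) 1)"
  using assms
proof (induction A)
  case empty
  then show ?case by (intro exI[of _ 1]) auto
next
  case (insert q A)
  then obtain d a where d: "d \<noteq> 0" "\<forall>q\<in>A. Fract d 1 * c q = Fract (a q) 1" by blast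
  obtain u v where uv: "c q = Fract u v" "v \<noteq> 0" by (cases "c q") auto
  have "Fract (d * v) 1 * c q = Fract (d * u) 1"
    using uv by (simp add: eq_fract)
  moreover have "Fract (d * v) 1 * c x = Fract (v * a x) 1" if "x \<in> A" for x
  proof -
    have "Fract (d * v) 1 * c x = Fract v 1 * (Fract d 1 * c x)"
      by (simp add: ac_simps flip: mult.assoc)
    then show ?thesis using d that by simp
  qed
  ultimately show ?case
    using d(1) uv(2) insert.hyps(2)
    by (intro exI[of _ "d * v"] exI[of _ "\<lambda>x. if x = q then d * u else v * a x"]) auto
qed

lemma fract_vec_clear_denominators:
  fixes x :: "'a::idom fract ^ 'n::finite"
  obtains d p where "d \<noteq> 0" "Fract d 1 *s x = fract_vec p"
proof -
  obtain d a where "d \<noteq> 0" "\<forall>j\<in>UNIV. Fract d 1 * x $ j = Fract (a j) 1"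
    using common_denominator[of "UNIV :: 'n set" "\<lambda>j. x $ j"] by auto
  then show ?thesis by (intro that[of d "\<chi> j. a j"]) (auto simp: vec_eq_iff)
qed

text \<open>Clearing denominators turns any rational vector orthogonal to \<open>S\<close> into a
  multiple over the domain, so the annihilator over the domain spans the one over the fraction
  field, and rank-nullity carries over.\<close>

lemma dim_add_dim_annihilator_fract:
  fixes S :: "('a::idom ^ 'n::finite) set"
  shows "vec.dim (fract_vec ` S) + vec.dim (fract_vec ` annihilator S) = CARD('n)"
proof -
  let ?N = "{x. \<forall>s\<in>fract_vec ` S. (\<Sum>j\<in>UNIV. s $ j * x $ j) = 0}"
  have sub: "fract_vec ` annihilator S \<subseteq> ?N"
    by (auto simp: annihilator_def sum_Fract_1)
  have "?N \<subseteq> vec.span (fract_vec ` annihilator S)"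
  proof
    fix x assume x: "x \<in> ?N"
    obtain d p where d: "d \<noteq> 0" "Fract d 1 *s x = fract_vec p"
      by (rule fract_vec_clear_denominators)
    have "(\<Sum>j\<in>UNIV. s $ j * p $ j) = 0" if "s \<in> S" for s
    proof -
      have "Fract (\<Sum>j\<in>UNIV. s $ j * p $ j) 1 = (\<Sum>j\<in>UNIV. Fract (s $ j) 1 * fract_vec p $ j)"
        by (simp add: sum_Fract_1)
      also have "\<dots> = Fract d 1 * (\<Sum>j\<in>UNIV. Fract (s $ j) 1 * x $ j)"
        unfolding d(2)[symmetric] by (simp add: sum_distrib_left ac_simps)
      also have "\<dots> = 0" using x that by auto
      finally show ?thesis by simp
    qed
    then have "p \<in> annihilator S" by (simp add: annihilator_def)
    then have "inverse (Fract d 1) *s fract_vec p \<in> vec.span (fract_vec ` annihilator S)"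
      by (intro vec.span_scale vec.span_base) auto
    moreover have "inverse (Fract d 1) *s fract_vec p = x"
      unfolding d(2)[symmetric] using d(1) by (simp del: inverse_fract)
    ultimately show "x \<in> vec.span (fract_vec ` annihilator S)" by simp
  qed
  with sub have "vec.dim ?N = vec.dim (fract_vec ` annihilator S)"
    by (meson vec.dim_mono vec.dim_subset order_antisym)
  then show ?thesis using dim_add_dim_annihilator[of "fract_vec ` S"] by (simp add: annihilator_def)
qed

text \<open>The map \<open>\<phi>\<close> twists scalars by \<open>\<sigma>\<close>, as the
  substitution of \<open>-\<xi>\<close> for \<open>\<xi>\<close> does, so independence is
  transported by hand. A relation between the images is cleared of denominators, its coefficients
  are pulled back through \<open>\<sigma>\<close>, and injectivity yields a relation between the
  original vectors.\<close>

lemma dim_semilinear_image_ge: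
  fixes \<phi> :: "'a::idom ^ 'n::finite \<Rightarrow> 'a ^ 'n"
  assumes add: "\<And>p q. \<phi> (p + q) = \<phi> p + \<phi> q"
    and scale: "\<And>c p. \<phi> (c *s p) = \<sigma> c *s \<phi> p"
    and inj: "\<And>p. \<phi> p = 0 \<Longrightarrow> p = 0"
    and surj: "surj \<sigma>" and \<sigma>0: "\<sigma> 0 = 0"
  shows "vec.dim (fract_vec ` P) \<le> vec.dim (fract_vec ` \<phi> ` P)"
proof -
  obtain B where B: "B \<subseteq> fract_vec ` P" "vec.independent B" "card B = vec.dim (fract_vec ` P)"
    by (rule vec.basis_exists[of "fract_vec ` P"])
  obtain Q where Q: "Q \<subseteq> P" "inj_on fract_vec Q" "B = fract_vec ` Q"
    using B(1) unfolding subset_image_inj by blast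
  have inj_fract: "inj fract_vec" by (rule injI) (simp only: fract_vec_eq_iff)
  have fB: "finite B" using B(2) vec.finiteI_independent by blast
  then have fQ: "finite Q" using Q by (simp add: finite_image_iff)
  have \<phi>0: "\<phi> 0 = 0" using add[of 0 0] by simp
  have \<phi>sum: "\<phi> (sum f A) = (\<Sum>a\<in>A. \<phi> (f a))" for f :: "'a ^ 'n \<Rightarrow> _" and A
    by (induction A rule: infinite_finite_induct) (auto simp: \<phi>0 add)
  have "inj \<phi>"
  proof (rule injI)
    fix x y assume "\<phi> x = \<phi> y"
    then have "\<phi> (x - y) = 0" using add[of "x - y" y] by simp
    then show "x = y" using inj by fastforce
  qed
  then have inj_Q: "inj_on (fract_vec \<circ> \<phi>) Q"
    using inj_compose[OF inj_fract] inj_on_subset by blast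
  have "vec.independent ((fract_vec \<circ> \<phi>) ` Q)"
  proof (rule vec.independent_if_scalars_zero)
    fix f :: "'a fract ^ 'n \<Rightarrow> 'a fract" and x
    assume 0: "(\<Sum>x\<in>(fract_vec \<circ> \<phi>) ` Q. f x *s x) = 0" and x: "x \<in> (fract_vec \<circ> \<phi>) ` Q"
    define c where "c = f \<circ> (fract_vec \<circ> \<phi>)"
    have c0: "(\<Sum>q\<in>Q. c q *s fract_vec (\<phi> q)) = 0"
      using 0 sum.reindex[OF inj_Q, of "\<lambda>x. f x *s x"] by (simp only: c_def comp_def)
    obtain d a where d: "d \<noteq> 0" "\<forall>q\<in>Q. Fract d 1 * c q = Fract (a q) 1"
      using common_denominator[OF fQ, of c] by blast
    define b where "b q = inv \<sigma> (a q)" for q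
    have b: "a q = \<sigma> (b q)" for q by (simp add: b_def surj_f_inv_f[OF surj])
    have "fract_vec (\<Sum>q\<in>Q. a q *s \<phi> q) = (\<Sum>q\<in>Q. Fract (a q) 1 *s fract_vec (\<phi> q))"
      by (simp add: vec_eq_iff sum_Fract_1)
    also have "\<dots> = (\<Sum>q\<in>Q. Fract d 1 *s (c q *s fract_vec (\<phi> q)))"
      using d(2) by (intro sum.cong) (auto simp: vec_eq_iff simp flip: mult.assoc)
    also have "\<dots> = 0"
      by (simp only: c0 vec.scale_zero_right flip: vec.scale_sum_right)
    finally have "(\<Sum>q\<in>Q. a q *s \<phi> q) = 0" by (simp add: vec_eq_iff)
    then have "\<phi> (\<Sum>q\<in>Q. b q *s q) = 0" by (simp add: \<phi>sum scale b)
    then have "(\<Sum>q\<in>Q. b q *s q) = 0" by (rule inj)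
    moreover have "(\<Sum>q\<in>Q. Fract (b q) 1 *s fract_vec q) = fract_vec (\<Sum>q\<in>Q. b q *s q)"
      by (simp add: vec_eq_iff sum_Fract_1)
    ultimately have "(\<Sum>q\<in>Q. Fract (b q) 1 *s fract_vec q) = 0"
      by (simp add: vec_eq_iff)
    \<comment> \<open>Independence of \<open>B\<close> is stated for coefficients indexed by its
      vectors, so \<open>b\<close> is carried along the inverse of \<open>fract_vec\<close> on
      \<open>Q\<close>.\<close>
    then have s0: "(\<Sum>v\<in>B. Fract (b (the_inv_into Q fract_vec v)) 1 *s v) = 0"
      unfolding Q(3) sum.reindex[OF Q(2)] using the_inv_into_f_f[OF Q(2)] by simp
    have "b q = 0" if "q \<in> Q" for q
      using B(2) s0 that the_inv_into_f_f[OF Q(2) that] Q(3)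
      unfolding vec.independent_explicit by fastforce
    then have "Fract d 1 * c q = 0" if "q \<in> Q" for q
      using d(2) b \<sigma>0 that by simp
    then have "c q = 0" if "q \<in> Q" for q using that d(1) by simp
    then show "f x = 0" using x by (auto simp: c_def)
  qed (use fQ in auto)
  moreover have "(fract_vec \<circ> \<phi>) ` Q \<subseteq> fract_vec ` \<phi> ` P" using Q(1) by auto
  ultimately have "card ((fract_vec \<circ> \<phi>) ` Q) \<le> vec.dim (fract_vec ` \<phi> ` P)"
    by (intro vec.independent_card_le_dim)
  then show ?thesis
    using B(3)[unfolded Q(3)] card_image[OF inj_Q] card_image[OF Q(2)] by linarith
qed

subsection \<open>Smooth functions and test functions\<close>

lemma nth_vderiv_0 [simp]: "nth_vderiv 0 w = w"
  by (simp add: nth_vderiv_def)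

lemma nth_vderiv_Suc: "nth_vderiv (Suc k) w t = vector_derivative (nth_vderiv k w) (at t)"
  by (simp add: nth_vderiv_def)

lemma nth_vderiv_nth_vderiv: "nth_vderiv k (nth_vderiv l w) = nth_vderiv (k + l) w"
  by (simp add: nth_vderiv_def funpow_add)

lemma C_infinity_has_vector_derivative:
  assumes "w \<in> C_infinity"
  shows "(nth_vderiv k w has_vector_derivative nth_vderiv (Suc k) w t) (at t)"
  using assms by (simp add: C_infinity_def nth_vderiv_Suc flip: vector_derivative_works)

lemma C_infinity_has_real_derivative:
  assumes "f \<in> C_infinity"
  shows "(nth_vderiv k f has_real_derivative nth_vderiv (Suc k) f t) (at t)"
  using C_infinity_has_vector_derivative[OF assms]
  by (simp add: has_real_derivative_iff_has_vector_derivative)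

lemma nth_vderiv_in_C_infinity: "w \<in> C_infinity \<Longrightarrow> nth_vderiv k w \<in> C_infinity"
  by (simp add: C_infinity_def nth_vderiv_nth_vderiv)

lemma C_infinity_continuous_on: "w \<in> C_infinity \<Longrightarrow> continuous_on S w"
  using C_infinity_has_vector_derivative[of w 0]
  by (auto intro!: continuous_at_imp_continuous_on has_vector_derivative_continuous)

text \<open>A tower \<open>G\<close> of functions, each the derivative of its predecessor, consists
  of the higher derivatives of its bottom function. Smoothness is proved below by exhibiting such
  towers.\<close>

lemma nth_vderiv_eqI:
  assumes "G 0 = w" "\<And>k t. (G k has_vector_derivative G (Suc k) t) (at t)"
  shows "nth_vderiv k w = G k"
proof (induction k)
  case (Suc k)
  then show ?case
    using assms(2)[of k] by (intro ext) (simp add: nth_vderiv_Suc vector_derivative_at)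
qed (simp add: assms)

lemma C_infinityI:
  assumes "G 0 = w" "\<And>k t. (G k has_vector_derivative G (Suc k) t) (at t)"
  shows "w \<in> C_infinity"
proof -
  have "nth_vderiv k w differentiable (at t)" for k t
    unfolding nth_vderiv_eqI[of G, OF assms] using assms(2) by (rule differentiableI_vector)
  then show ?thesis by (simp add: C_infinity_def)
qed

text \<open>Derivatives depend only on the germ at a point; openness of \<open>S\<close> makes the
  induction hypothesis available on a whole neighbourhood.\<close>

lemma nth_vderiv_cong_open:
  assumes "open S" "\<And>t. t \<in> S \<Longrightarrow> f t = g t" "t \<in> S"
  shows "nth_vderiv k f t = nth_vderiv k g t"
  using assms(3)
proof (induction k arbitrary: t)
  case (Suc k)
  have "\<forall>\<^sub>F x in nhds t. x \<in> UNIV \<longrightarrow> nth_vderiv k f x = nth_vderiv k g x"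
    using Suc assms(1) by (auto simp: eventually_nhds)
  then show ?case
    unfolding nth_vderiv_Suc by (intro vector_derivative_cong_eq) auto
qed (use assms in auto)

lemma nth_vderiv_const_0: "nth_vderiv k (\<lambda>t. 0) = (\<lambda>t. 0)"
  by (rule nth_vderiv_eqI[where G = "\<lambda>k t. 0"]) auto

lemma nth_vderiv_lincomb_deriv:
  fixes f :: "'i \<Rightarrow> real \<Rightarrow> real"
  assumes "\<And>i. i \<in> A \<Longrightarrow> f i \<in> C_infinity"
  shows "((\<lambda>t. \<Sum>i\<in>A. c i * nth_vderiv k (f i) t) has_vector_derivative
    (\<Sum>i\<in>A. c i * nth_vderiv (Suc k) (f i) t)) (at t)"
  unfolding has_real_derivative_iff_has_vector_derivative[symmetric]
  using assms by (intro DERIV_sum DERIV_cmult C_infinity_has_real_derivative)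

lemma nth_vderiv_lincomb:
  fixes f :: "'i \<Rightarrow> real \<Rightarrow> real"
  assumes "\<And>i. i \<in> A \<Longrightarrow> f i \<in> C_infinity"
  shows "nth_vderiv k (\<lambda>t. \<Sum>i\<in>A. c i * f i t) = (\<lambda>t. \<Sum>i\<in>A. c i * nth_vderiv k (f i) t)"
  by (rule nth_vderiv_eqI[where G = "\<lambda>k t. \<Sum>i\<in>A. c i * nth_vderiv k (f i) t"])
    (use nth_vderiv_lincomb_deriv[OF assms] in auto)

lemma C_infinity_lincomb:
  fixes f :: "'i \<Rightarrow> real \<Rightarrow> real"
  assumes "\<And>i. i \<in> A \<Longrightarrow> f i \<in> C_infinity"
  shows "(\<lambda>t. \<Sum>i\<in>A. c i * f i t) \<in> C_infinity"
  by (rule C_infinityI[where G = "\<lambda>k t. \<Sum>i\<in>A. c i * nth_vderiv k (f i) t"])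
    (use nth_vderiv_lincomb_deriv[OF assms] in auto)

lemma C_infinity_0: "(\<lambda>t. 0) \<in> C_infinity"
  by (rule C_infinityI[where G = "\<lambda>k t. 0"]) auto

text \<open>Every function in a set that is closed under differentiation is smooth; this replaces the
  Leibniz formula for higher derivatives of a product.\<close>

inductive_set product_sums :: "(real \<Rightarrow> real) set" where
  mult: "f \<in> C_infinity \<Longrightarrow> g \<in> C_infinity \<Longrightarrow> (\<lambda>t. f t * g t) \<in> product_sums"
| add: "h1 \<in> product_sums \<Longrightarrow> h2 \<in> product_sums \<Longrightarrow> (\<lambda>t. h1 t + h2 t) \<in> product_sums"

lemma product_sums_deriv:
  assumes "h \<in> product_sums"
  shows "\<exists>h'\<in>product_sums. \<forall>t. (h has_real_derivative h' t) (at t)"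
  using assms
proof induction
  case (mult f g)
  have "(\<lambda>t. nth_vderiv 1 f t * g t + f t * nth_vderiv 1 g t) \<in> product_sums"
    using mult by (intro product_sums.intros nth_vderiv_in_C_infinity)
  moreover have "((\<lambda>t. f t * g t) has_real_derivative
      nth_vderiv 1 f t * g t + f t * nth_vderiv 1 g t) (at t)" for t
    using C_infinity_has_real_derivative[of _ 0 t] mult
    by (auto intro!: derivative_eq_intros)
  ultimately show ?case
    by (intro bexI[of _ "\<lambda>t. nth_vderiv 1 f t * g t + f t * nth_vderiv 1 g t"]) auto
next
  case (add h1 h2)
  then obtain h1' h2' where "h1' \<in> product_sums" "h2' \<in> product_sums"
      "\<forall>t. (h1 has_real_derivative h1' t) (at t)" "\<forall>t. (h2 has_real_derivative h2' t) (at t)"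
    by blast
  then show ?case
    by (intro bexI[of _ "\<lambda>t. h1' t + h2' t"] allI DERIV_add product_sums.intros) auto
qed

lemma C_infinity_mult:
  fixes f g :: "real \<Rightarrow> real"
  assumes "f \<in> C_infinity" "g \<in> C_infinity"
  shows "(\<lambda>t. f t * g t) \<in> C_infinity"
proof -
  \<comment> \<open>Here \<open>d\<close> selects a derivative within \<open>product_sums\<close>;
    iterating it from the product gives the tower.\<close>
  obtain d where d: "\<And>h. h \<in> product_sums \<Longrightarrow> d h \<in> product_sums"
      "\<And>h t. h \<in> product_sums \<Longrightarrow> (h has_real_derivative d h t) (at t)"
    using product_sums_deriv by metis
  define G where "G k = (d ^^ k) (\<lambda>t. f t * g t)" for k
  have G: "G k \<in> product_sums" for k
    by (induction k) (auto simp: G_def assms product_sums.mult d(1))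
  have "(G k has_vector_derivative G (Suc k) t) (at t)" for k t
    using d(2)[OF G[of k]]
    by (simp add: G_def flip: has_real_derivative_iff_has_vector_derivative)
  then show ?thesis by (intro C_infinityI[of G]) (auto simp: G_def)
qed

text \<open>The classical smooth function \<open>exp (-1/t)\<close>, with a polynomial factor in \<open>1/t\<close> so that the
  family is closed under differentiation.\<close>

definition flat :: "real poly \<Rightarrow> real \<Rightarrow> real" where
  "flat P t = (if t > 0 then poly P (inverse t) * exp (- inverse t) else 0)"

lemma tendsto_poly_mult_exp_minus: "((\<lambda>y. poly P y * exp (- y)) \<longlongrightarrow> (0::real)) at_top"
proof -
  have "((\<lambda>y. \<Sum>i\<le>degree P. coeff P i * (y ^ i / exp y)) \<longlongrightarrow> (\<Sum>i\<le>degree P. coeff P i * 0)) at_top"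
    by (intro tendsto_intros tendsto_power_div_exp_0)
  then show ?thesis
    by (simp add: poly_altdef exp_minus sum_divide_distrib divide_inverse[symmetric])
qed

text \<open>With \<open>y = 1/t\<close>, the chain rule gives
  \<open>y\<^sup>2 (P(y) - P'(y)) exp (-y)\<close> for \<open>t > 0\<close>; at the origin,
  exponential decay beats every polynomial.\<close>

lemma flat_has_real_derivative:
  "(flat P has_real_derivative flat ([:0, 0, 1:] * (P - pderiv P)) t) (at t)"
proof -
  consider "t > 0" | "t < 0" | "t = 0" by linarith
  then show ?thesis
  proof cases
    case 1
    have "((\<lambda>t. poly P (inverse t) * exp (- inverse t)) has_real_derivative
        flat ([:0, 0, 1:] * (P - pderiv P)) t) (at t)"
      using 1 by (auto intro!: derivative_eq_intros DERIV_chain2[OF poly_DERIV]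
          simp: flat_def power2_eq_square field_simps)
    then show ?thesis
      by (rule has_field_derivative_transform_within_open[where S = "{0<..}"])
        (use 1 in \<open>auto simp: flat_def\<close>)
  next
    case 2
    have "((\<lambda>t. 0) has_real_derivative flat ([:0, 0, 1:] * (P - pderiv P)) t) (at t)"
      using 2 by (auto simp: flat_def)
    then show ?thesis
      by (rule has_field_derivative_transform_within_open[where S = "{..<0}"])
        (use 2 in \<open>auto simp: flat_def\<close>)
  next
    case 3
    \<comment> \<open>Here \<open>pCons 0 P\<close> is \<open>P\<close> times the variable, which
      accounts for the division by \<open>y\<close> in the difference quotient
      \<open>flat P y / y\<close>.\<close>
    have "((\<lambda>y. poly (pCons 0 P) (inverse y) * exp (- inverse y)) \<longlongrightarrow> 0) (at_right (0::real))"
      by (rule filterlim_compose[OF tendsto_poly_mult_exp_minus filterlim_inverse_at_top_right])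
    then have "((\<lambda>y. flat P y / y) \<longlongrightarrow> 0) (at_right 0)"
      by (rule Lim_transform_eventually)
        (auto simp: eventually_at_right_field flat_def field_simps intro!: exI[of _ 1])
    moreover have "((\<lambda>y. flat P y / y) \<longlongrightarrow> 0) (at_left 0)"
      by (rule Lim_transform_eventually[OF tendsto_const])
        (auto simp: eventually_at_left_field flat_def intro!: exI[of _ "-1"])
    ultimately have "((\<lambda>y. flat P y / y) \<longlongrightarrow> 0) (at 0)"
      by (rule filterlim_split_at[rotated])
    then show ?thesis
      using 3 by (simp add: has_field_derivative_iff) (simp add: flat_def)
  qed
qed

lemma flat_in_C_infinity: "flat P \<in> C_infinity"
  by (rule C_infinityI[where G = "\<lambda>k. flat (((\<lambda>P. [:0, 0, 1:] * (P - pderiv P)) ^^ k) P)"])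
    (auto simp: flat_has_real_derivative simp flip: has_real_derivative_iff_has_vector_derivative
      simp del: mult_pCons_left)

text \<open>The reflection exchanges 0 and 1 and provides the factor of the bump function that
  vanishes from 1 onwards. Each differentiation contributes one sign.\<close>

lemma C_infinity_reflect:
  fixes f :: "real \<Rightarrow> real"
  assumes "f \<in> C_infinity"
  shows "(\<lambda>t. f (1 - t)) \<in> C_infinity"
proof (rule C_infinityI[where G = "\<lambda>k t. (-1) ^ k * nth_vderiv k f (1 - t)"])
  fix k t
  have "((\<lambda>t. 1 - t) has_real_derivative -1) (at t)"
    by (auto intro!: derivative_eq_intros)
  from DERIV_cmult[OF DERIV_chain2[OF C_infinity_has_real_derivative[OF assms] this], of "(-1) ^ k" k]
  show "((\<lambda>t. (-1) ^ k * nth_vderiv k f (1 - t)) has_vector_derivative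
      (-1) ^ Suc k * nth_vderiv (Suc k) f (1 - t)) (at t)"
    by (simp flip: has_real_derivative_iff_has_vector_derivative)
qed auto

section \<open>Compactly supported scalar functions and integration by parts\<close>

text \<open>Compact support is expressed as vanishing for large \<open>\<bar>t\<bar>\<close>, the
  form used in the integrations; \<open>image_signal_in_test_functions\<close> returns to closures
  of supports.\<close>

definition scalar_tests :: "(real \<Rightarrow> real) set" where
  "scalar_tests = {f \<in> C_infinity. \<exists>a. \<forall>t. \<bar>t\<bar> > a \<longrightarrow> f t = 0}"

text \<open>The product of \<open>flat 1\<close> with its mirror image is positive on the open
  interval from 0 to 1 and zero elsewhere.\<close>

lemma scalar_tests_nontrivial: "\<exists>f\<in>scalar_tests. \<exists>t. f t \<noteq> 0"
proof (intro bexI exI)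
  let ?f = "\<lambda>t. flat 1 t * flat 1 (1 - t)"
  show "?f \<in> scalar_tests"
    unfolding scalar_tests_def
  proof (intro CollectI conjI exI[of _ 1])
    show "?f \<in> C_infinity"
      by (intro C_infinity_mult C_infinity_reflect flat_in_C_infinity)
  qed (auto simp: flat_def)
  show "?f (1 / 2) \<noteq> 0" by (simp add: flat_def)
qed

lemma scalar_tests_nth_vderiv:
  assumes "f \<in> scalar_tests"
  shows "nth_vderiv k f \<in> scalar_tests"
proof -
  obtain a where a: "\<forall>t. \<bar>t\<bar> > a \<longrightarrow> f t = 0" using assms by (auto simp: scalar_tests_def)
  have "nth_vderiv k f t = 0" if "\<bar>t\<bar> > a" for t
  proof -
    have "open {t :: real. \<bar>t\<bar> > a}" by (intro open_Collect_less continuous_intros)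
    then have "nth_vderiv k f t = nth_vderiv k (\<lambda>t. 0) t"
      using a that by (intro nth_vderiv_cong_open[of "{t. \<bar>t\<bar> > a}"]) auto
    then show ?thesis by (simp add: nth_vderiv_const_0)
  qed
  then show ?thesis
    using assms nth_vderiv_in_C_infinity by (auto simp: scalar_tests_def)
qed

lemma scalar_tests_mult:
  "f \<in> scalar_tests \<Longrightarrow> g \<in> C_infinity \<Longrightarrow> (\<lambda>t. f t * g t) \<in> scalar_tests"
  unfolding scalar_tests_def using C_infinity_mult by fastforce

lemma scalar_tests_in_C_infinity: "f \<in> scalar_tests \<Longrightarrow> f \<in> C_infinity"
  by (simp add: scalar_tests_def)

lemma scalar_tests_integrable:
  assumes "f \<in> scalar_tests"
  shows "f integrable_on UNIV"
proof -
  obtain a where a: "\<forall>t. \<bar>t\<bar> > a \<longrightarrow> f t = 0" using assms by (auto simp: scalar_tests_def)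
  have "f integrable_on {-a..a}"
    using assms
    by (intro integrable_continuous_real C_infinity_continuous_on scalar_tests_in_C_infinity)
  then show ?thesis
    by (rule integrable_on_superset) (use a in auto)
qed

lemma scalar_tests_integral_deriv:
  assumes "f \<in> scalar_tests"
  shows "integral UNIV (nth_vderiv 1 f) = 0"
proof -
  obtain a where a: "\<forall>t. \<bar>t\<bar> > a \<longrightarrow> f t = 0" using assms by (auto simp: scalar_tests_def)
  obtain b where b: "\<forall>t. \<bar>t\<bar> > b \<longrightarrow> nth_vderiv 1 f t = 0"
    using scalar_tests_nth_vderiv[OF assms, of 1] by (auto simp: scalar_tests_def)
  \<comment> \<open>This exceeds both bounds strictly, so \<open>f\<close> vanishes at the end
    points \<open>c\<close> and \<open>- c\<close>, and its derivative vanishes outside the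
    interval.\<close>
  define c where "c = max 0 (max a b) + 1"
  have "(nth_vderiv 1 f has_integral f c - f (- c)) {- c..c}"
  proof (rule fundamental_theorem_of_calculus)
    show "(f has_vector_derivative nth_vderiv 1 f t) (at t within {- c..c})" for t
      using C_infinity_has_vector_derivative[OF scalar_tests_in_C_infinity[OF assms], of 0 t]
      by (simp add: has_vector_derivative_at_within)
  qed (simp add: c_def)
  moreover have "f c = 0" "f (- c) = 0" using a by (auto simp: c_def)
  ultimately have "(nth_vderiv 1 f has_integral 0) {- c..c}" by simp
  moreover have "nth_vderiv 1 f t = 0" if "t \<notin> {- c..c}" for t
    using that by (intro b[rule_format]) (auto simp: c_def)
  ultimately have "(nth_vderiv 1 f has_integral 0) UNIV"
    by (rule has_integral_on_superset) auto
  then show ?thesis by (rule integral_unique)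
qed

text \<open>The derivative of the test function \<open>f t * g t\<close> has integral 0, and the
  product rule splits it into the two integrands.\<close>

lemma integration_by_parts_scalar_tests:
  assumes f: "f \<in> scalar_tests" and g: "g \<in> C_infinity"
  shows "integral UNIV (\<lambda>t. nth_vderiv 1 f t * g t) = - integral UNIV (\<lambda>t. f t * nth_vderiv 1 g t)"
proof -
  have fC: "f \<in> C_infinity" using f by (rule scalar_tests_in_C_infinity)
  have eq: "nth_vderiv 1 (\<lambda>t. f t * g t) = (\<lambda>t. nth_vderiv 1 f t * g t + f t * nth_vderiv 1 g t)"
  proof
    fix t
    have "((\<lambda>t. f t * g t) has_real_derivative nth_vderiv 1 f t * g t + f t * nth_vderiv 1 g t) (at t)"
      using C_infinity_has_real_derivative[of _ 0 t] fC g
      by (auto intro!: derivative_eq_intros)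
    then show "nth_vderiv 1 (\<lambda>t. f t * g t) t = nth_vderiv 1 f t * g t + f t * nth_vderiv 1 g t"
      by (simp add: nth_vderiv_Suc has_real_derivative_iff_has_vector_derivative
          vector_derivative_at)
  qed
  have "(\<lambda>t. nth_vderiv 1 f t * g t) integrable_on UNIV"
    by (rule scalar_tests_integrable scalar_tests_mult scalar_tests_nth_vderiv f g)+
  moreover have "(\<lambda>t. f t * nth_vderiv 1 g t) integrable_on UNIV"
    by (rule scalar_tests_integrable scalar_tests_mult nth_vderiv_in_C_infinity f g)+
  moreover have "integral UNIV (\<lambda>t. nth_vderiv 1 f t * g t + f t * nth_vderiv 1 g t) = 0"
    using scalar_tests_integral_deriv[OF scalar_tests_mult[OF f g]] eq by simp
  ultimately show ?thesis by (simp only: integral_add eq_neg_iff_add_eq_0)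
qed

subsection \<open>Scalar differential operators with constant coefficients\<close>

definition poly_diff :: "real poly \<Rightarrow> (real \<Rightarrow> real) \<Rightarrow> real \<Rightarrow> real" where
  "poly_diff p f t = (\<Sum>k\<le>degree p. coeff p k * nth_vderiv k f t)"

text \<open>Coefficients beyond the degree are 0, so polynomials of different degrees can share one
  summation range.\<close>

lemma poly_diff_eq_sum:
  assumes "degree p \<le> n"
  shows "poly_diff p f t = (\<Sum>k\<le>n. coeff p k * nth_vderiv k f t)"
  unfolding poly_diff_def using assms
  by (intro sum.mono_neutral_left) (auto simp: coeff_eq_0)

lemma poly_diff_0 [simp]: "poly_diff 0 f t = 0"
  by (simp add: poly_diff_def)

lemma poly_diff_add: "poly_diff (p + q) f t = poly_diff p f t + poly_diff q f t"
proof -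
  let ?n = "max (degree p) (degree q)"
  have "degree (p + q) \<le> ?n" by (rule degree_add_le_max)
  then show ?thesis
    by (simp add: poly_diff_eq_sum[of _ ?n] algebra_simps sum.distrib)
qed

lemma poly_diff_smult: "poly_diff (smult c p) f t = c * poly_diff p f t"
proof -
  have "degree (smult c p) \<le> degree p" by (rule degree_smult_le)
  then show ?thesis
    by (simp add: poly_diff_eq_sum[of _ "degree p"] algebra_simps sum_distrib_left)
qed

lemma poly_diff_minus: "poly_diff (- p) f t = - poly_diff p f t"
  using poly_diff_smult[of "-1" p f t] by simp

lemma poly_diff_sum: "poly_diff (\<Sum>i\<in>A. p i) f t = (\<Sum>i\<in>A. poly_diff (p i) f t)"
  by (induction A rule: infinite_finite_induct) (auto simp: poly_diff_add)

lemma poly_diff_pCons: "poly_diff (pCons a p) f t = a * f t + poly_diff p (nth_vderiv 1 f) t"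
proof -
  have "poly_diff (pCons a p) f t = (\<Sum>k\<le>Suc (degree p). coeff (pCons a p) k * nth_vderiv k f t)"
    by (intro poly_diff_eq_sum degree_pCons_le)
  also have "\<dots> = a * f t + poly_diff p (nth_vderiv 1 f) t"
    by (subst sum.atMost_Suc_shift) (simp add: poly_diff_def nth_vderiv_nth_vderiv)
  finally show ?thesis .
qed

lemma poly_diff_in_C_infinity: "f \<in> C_infinity \<Longrightarrow> poly_diff p f \<in> C_infinity"
  unfolding poly_diff_def by (intro C_infinity_lincomb nth_vderiv_in_C_infinity)

lemma nth_vderiv_poly_diff:
  assumes "f \<in> C_infinity"
  shows "nth_vderiv k (poly_diff p f) = poly_diff p (nth_vderiv k f)"
proof -
  have "nth_vderiv k (poly_diff p f) = (\<lambda>t. \<Sum>i\<le>degree p. coeff p i * nth_vderiv k (nth_vderiv i f) t)"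
    unfolding poly_diff_def using assms by (intro nth_vderiv_lincomb nth_vderiv_in_C_infinity)
  then show ?thesis
    by (auto simp: poly_diff_def nth_vderiv_nth_vderiv add.commute)
qed

text \<open>Multiplying by the variable corresponds to one more differentiation, which commutes with
  constant-coefficient operators. Smooth functions thus become a module over
  \<open>real poly\<close>.\<close>

lemma poly_diff_mult:
  assumes "f \<in> C_infinity"
  shows "poly_diff (p * q) f t = poly_diff p (poly_diff q f) t"
  using assms
proof (induction p arbitrary: f)
  case (pCons a p)
  then show ?case
    by (simp add: poly_diff_add poly_diff_smult poly_diff_pCons nth_vderiv_poly_diff
        nth_vderiv_in_C_infinity)
qed auto

lemma poly_diff_lincomb:
  assumes "\<And>i. i \<in> A \<Longrightarrow> f i \<in> C_infinity"
  shows "poly_diff p (\<lambda>t. \<Sum>i\<in>A. c i * f i t) t = (\<Sum>i\<in>A. c i * poly_diff p (f i) t)"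
proof -
  have "poly_diff p (\<lambda>t. \<Sum>i\<in>A. c i * f i t) t =
      (\<Sum>k\<le>degree p. \<Sum>i\<in>A. c i * (coeff p k * nth_vderiv k (f i) t))"
    by (simp add: poly_diff_def nth_vderiv_lincomb[OF assms] sum_distrib_left ac_simps)
  also have "\<dots> = (\<Sum>i\<in>A. c i * poly_diff p (f i) t)"
    by (subst sum.swap) (simp add: poly_diff_def sum_distrib_left)
  finally show ?thesis .
qed

lemma poly_diff_cong_open:
  assumes "open S" "\<And>t. t \<in> S \<Longrightarrow> f t = g t" "t \<in> S"
  shows "poly_diff p f t = poly_diff p g t"
  unfolding poly_diff_def using nth_vderiv_cong_open[of S f g, OF assms] by simp

lemma poly_diff_scalar_tests: "f \<in> scalar_tests \<Longrightarrow> poly_diff p f \<in> scalar_tests"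
proof -
  assume f: "f \<in> scalar_tests"
  then obtain a where a: "\<forall>t. \<bar>t\<bar> > a \<longrightarrow> f t = 0" by (auto simp: scalar_tests_def)
  have "poly_diff p f t = 0" if "\<bar>t\<bar> > a" for t
  proof -
    have "open {t :: real. \<bar>t\<bar> > a}" by (intro open_Collect_less continuous_intros)
    then have "poly_diff p f t = poly_diff p (\<lambda>t. 0) t"
      using a that by (intro poly_diff_cong_open[of "{t. \<bar>t\<bar> > a}"]) auto
    then show ?thesis by (simp add: poly_diff_def nth_vderiv_const_0)
  qed
  then show ?thesis
    using poly_diff_in_C_infinity[OF scalar_tests_in_C_infinity[OF f]]
    unfolding scalar_tests_def by blast
qed

text \<open>The formal adjoint of \<open>p(d/dt)\<close> is \<open>p(-d/dt)\<close>: each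
  integration by parts moves one derivative and changes one sign. Composition with
  \<open>[:0, -1:]\<close> substitutes \<open>-\<xi>\<close> for \<open>\<xi>\<close>.\<close>

lemma poly_diff_adjoint:
  assumes "f \<in> scalar_tests" "g \<in> C_infinity"
  shows "integral UNIV (\<lambda>t. poly_diff p f t * g t) =
    integral UNIV (\<lambda>t. f t * poly_diff (pcompose p [:0, -1:]) g t)"
  using assms(1)
proof (induction p arbitrary: f)
  case (pCons a p)
  let ?p = "pcompose p [:0, -1:]"
  note f = pCons.prems
  have f': "nth_vderiv 1 f \<in> scalar_tests" by (rule scalar_tests_nth_vderiv[OF f])
  have Dg: "poly_diff ?p g \<in> C_infinity" using assms(2) by (rule poly_diff_in_C_infinity)
  have int1: "(\<lambda>t. a * (f t * g t)) integrable_on UNIV"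
    by (intro integrable_on_mult_right scalar_tests_integrable scalar_tests_mult f assms(2))
  have int2: "(\<lambda>t. poly_diff p (nth_vderiv 1 f) t * g t) integrable_on UNIV"
    by (rule scalar_tests_integrable scalar_tests_mult poly_diff_scalar_tests f' assms(2))+
  have int3: "(\<lambda>t. f t * nth_vderiv 1 (poly_diff ?p g) t) integrable_on UNIV"
    by (rule scalar_tests_integrable scalar_tests_mult nth_vderiv_in_C_infinity Dg f)+
  have eq: "poly_diff (pcompose (pCons a p) [:0, -1:]) g t = a * g t - nth_vderiv 1 (poly_diff ?p g) t" for t
  proof -
    have "pcompose (pCons a p) [:0, -1:] = pCons a (- ?p)"
      by (simp add: pcompose_pCons)
    then show ?thesis
      by (simp add: poly_diff_minus poly_diff_pCons nth_vderiv_poly_diff assms(2))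
  qed
  have "integral UNIV (\<lambda>t. f t * poly_diff (pcompose (pCons a p) [:0, -1:]) g t)
      = integral UNIV (\<lambda>t. a * (f t * g t) - f t * nth_vderiv 1 (poly_diff ?p g) t)"
    unfolding eq by (simp only: right_diff_distrib mult.left_commute[of _ a])
  also have "\<dots> = integral UNIV (\<lambda>t. a * (f t * g t)) + integral UNIV (\<lambda>t. nth_vderiv 1 f t * poly_diff ?p g t)"
    unfolding integral_diff[OF int1 int3] integration_by_parts_scalar_tests[OF f Dg] by simp
  also have "\<dots> = integral UNIV (\<lambda>t. a * (f t * g t)) + integral UNIV (\<lambda>t. poly_diff p (nth_vderiv 1 f) t * g t)"
    using pCons.IH[OF f'] by simp
  also have "\<dots> = integral UNIV (\<lambda>t. a * (f t * g t) + poly_diff p (nth_vderiv 1 f) t * g t)"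
    by (rule integral_add[OF int1 int2, symmetric])
  also have "\<dots> = integral UNIV (\<lambda>t. poly_diff (pCons a p) f t * g t)"
    by (simp add: poly_diff_pCons algebra_simps)
  finally show ?case by simp
qed simp

section \<open>Uniqueness for scalar linear differential equations\<close>

text \<open>Gronwall's argument in both directions: \<open>E t * exp (- M * t)\<close> is
  nonincreasing, which settles the times after \<open>a\<close>, and
  \<open>E t * exp (M * t)\<close> is nondecreasing, which settles those before; nonnegativity pins
  both to 0.\<close>

lemma energy_vanishes:
  fixes E E' :: "real \<Rightarrow> real"
  assumes deriv: "\<And>t. (E has_real_derivative E' t) (at t)"
    and bound: "\<And>t. \<bar>E' t\<bar> \<le> M * E t" and nonneg: "\<And>t. E t \<ge> 0" and a: "E a = 0"
  shows "E t = 0"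
proof (cases "a \<le> t")
  case True
  have "E t * exp (- M * t) \<le> E a * exp (- M * a)"
  proof (rule DERIV_nonpos_imp_nonincreasing[OF True])
    fix x
    have "((\<lambda>t. E t * exp (- M * t)) has_real_derivative (E' x - M * E x) * exp (- M * x)) (at x)"
      by (auto intro!: derivative_eq_intros deriv simp: algebra_simps)
    moreover have "(E' x - M * E x) * exp (- M * x) \<le> 0"
      using bound[of x] by (intro mult_nonpos_nonneg) auto
    ultimately show "\<exists>y. ((\<lambda>t. E t * exp (- M * t)) has_real_derivative y) (at x) \<and> y \<le> 0" by blast
  qed
  then show ?thesis using nonneg[of t] a by (simp add: mult_le_0_iff)
next
  case False
  then have "t \<le> a" by simp
  have "E t * exp (M * t) \<le> E a * exp (M * a)"
  proof (rule DERIV_nonneg_imp_nondecreasing[OF \<open>t \<le> a\<close>])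
    fix x
    have "((\<lambda>t. E t * exp (M * t)) has_real_derivative (E' x + M * E x) * exp (M * x)) (at x)"
      by (auto intro!: derivative_eq_intros deriv simp: algebra_simps)
    moreover have "(E' x + M * E x) * exp (M * x) \<ge> 0"
      using bound[of x] by (intro mult_nonneg_nonneg) auto
    ultimately show "\<exists>y. ((\<lambda>t. E t * exp (M * t)) has_real_derivative y) (at x) \<and> y \<ge> 0" by blast
  qed
  then show ?thesis using nonneg[of t] a by (simp add: mult_le_0_iff)
qed

lemma poly_diff_unique_at:
  assumes f: "f \<in> C_infinity" and s: "s \<noteq> 0" and eq: "\<And>t. poly_diff s f t = 0"
    and init: "\<And>k. nth_vderiv k f a = 0"
  shows "f t = 0"
proof -
  define n c where "n = degree s" and "c = coeff s n"
  define F where "F k t = nth_vderiv k f t" for k t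
  \<comment> \<open>Since \<open>F n\<close> is a linear combination of the lower derivatives, the energy \<open>E\<close> satisfies
    \<open>\<bar>E'\<bar> \<le> M E\<close>, so a zero of \<open>E\<close> propagates by Gronwall's argument.\<close>
  define E where "E t = (\<Sum>k<n. (F k t)\<^sup>2)" for t
  define K where "K = (\<Sum>k<n. (coeff s k)\<^sup>2) / c\<^sup>2"
  have c: "c \<noteq> 0" using s by (simp add: c_def n_def)
  have E0: "E t \<ge> 0" for t by (simp add: E_def sum_nonneg)
  have K0: "K \<ge> 0" by (simp add: K_def sum_nonneg)
  have top: "(F n t)\<^sup>2 \<le> K * E t" for t
  proof -
    have "(\<Sum>k<n. coeff s k * F k t) + c * F n t = 0"
      using eq[of t] by (simp add: poly_diff_def n_def c_def F_def flip: lessThan_Suc_atMost)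
    then have "c * F n t = - (\<Sum>k<n. coeff s k * F k t)" by simp
    then have "c\<^sup>2 * (F n t)\<^sup>2 = (\<Sum>k<n. coeff s k * F k t)\<^sup>2"
      by (metis power2_minus power_mult_distrib)
    also have "\<dots> \<le> (\<Sum>k<n. (coeff s k)\<^sup>2) * E t"
      unfolding E_def by (rule Cauchy_Schwarz_ineq_sum)
    finally show ?thesis
      using c by (simp add: K_def field_simps)
  qed
  have le: "(F k t)\<^sup>2 \<le> E t" if "k < n" for k t
    unfolding E_def using that by (intro member_le_sum) auto
  have F': "(F k has_real_derivative F (Suc k) t) (at t)" for k t
    using C_infinity_has_real_derivative[OF f, of k t] by (simp add: F_def[abs_def])
  have "E t = 0" for t
  proof (rule energy_vanishes[where E = E and E' = "\<lambda>t. \<Sum>k<n. 2 * F k t * F (Suc k) t"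
        and M = "n * (2 + K)" and a = a])
    show "(E has_real_derivative (\<Sum>k<n. 2 * F k t * F (Suc k) t)) (at t)" for t
    proof -
      have "((\<lambda>t. (F k t)\<^sup>2) has_real_derivative 2 * F k t * F (Suc k) t) (at t)" for k
        using DERIV_power[OF F'[of k t], of 2] by (simp add: ac_simps)
      then show ?thesis unfolding E_def[abs_def] by (intro DERIV_sum)
    qed
    show "\<bar>\<Sum>k<n. 2 * F k t * F (Suc k) t\<bar> \<le> (n * (2 + K)) * E t" for t
    proof -
      \<comment> \<open>Each summand is bounded by the squares of two neighbouring derivatives. The
        lower one is at most \<open>E t\<close>, the upper one at most \<open>E t\<close> or, when
        \<open>Suc k = n\<close>, at most \<open>K * E t\<close>; this gives \<open>2 + K\<close>
        for each of the \<open>n\<close> summands.\<close>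
      have "\<bar>2 * F k t * F (Suc k) t\<bar> \<le> (2 + K) * E t" if "k < n" for k
      proof -
        have "\<bar>2 * F k t * F (Suc k) t\<bar> \<le> (F k t)\<^sup>2 + (F (Suc k) t)\<^sup>2"
          using sum_squares_bound[of "\<bar>F k t\<bar>" "\<bar>F (Suc k) t\<bar>"] by (simp add: abs_mult)
        moreover have "(F (Suc k) t)\<^sup>2 \<le> E t + K * E t"
        proof (cases "Suc k < n")
          case True
          then show ?thesis using le[of "Suc k" t] K0 E0[of t] by (simp add: add_increasing2)
        next
          case False
          then have "Suc k = n" using that by simp
          then show ?thesis using top[of t] E0[of t] by simp
        qed
        ultimately show ?thesis using le[OF that, of t] by (simp add: algebra_simps)
      qed
      then have "(\<Sum>k<n. \<bar>2 * F k t * F (Suc k) t\<bar>) \<le> (\<Sum>k<n. (2 + K) * E t)"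
        by (intro sum_mono) auto
      from order_trans[OF sum_abs this] show ?thesis by (simp add: mult.assoc)
    qed
    show "E a = 0" using init by (simp add: E_def F_def)
  qed (rule E0)
  \<comment> \<open>For \<open>n = 0\<close> the energy is an empty sum and \<open>top\<close>
    itself gives the claim; otherwise \<open>F 0\<close> contributes to the energy.\<close>
  then have "F 0 t = 0"
    using top[of t] le[of 0 t] by (cases n) (auto simp: E_def)
  then show ?thesis by (simp add: F_def)
qed

text \<open>Vanishing on an open set forces all derivatives to vanish at each of its points, so the
  initial data at \<open>a\<close> are 0.\<close>

lemma poly_diff_unique:
  assumes "f \<in> C_infinity" "s \<noteq> 0" "\<And>t. poly_diff s f t = 0"
    and "open S" "a \<in> S" "\<And>t. t \<in> S \<Longrightarrow> f t = 0"
  shows "f t = 0"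
proof (rule poly_diff_unique_at[OF assms(1-3)])
  show "nth_vderiv k f a = 0" for k
    using nth_vderiv_cong_open[of S f "\<lambda>t. 0" a k] assms(4-6) by (simp add: nth_vderiv_const_0)
qed

text \<open>A test function vanishes far out, so uniqueness for a nonzero \<open>s\<close> would
  make it identically 0. A single nonzero test function therefore detects whether a polynomial is
  0.\<close>

lemma poly_diff_scalar_test_eq_0:
  assumes f: "f \<in> scalar_tests" and nz: "f t0 \<noteq> 0" and eq: "\<And>t. poly_diff s f t = 0"
  shows "s = 0"
proof (rule ccontr)
  assume "s \<noteq> 0"
  obtain a where a: "\<forall>t. \<bar>t\<bar> > a \<longrightarrow> f t = 0" using f by (auto simp: scalar_tests_def)
  have "f t0 = 0"
    by (rule poly_diff_unique[OF scalar_tests_in_C_infinity[OF f] \<open>s \<noteq> 0\<close> eq,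
          of "{\<bar>a\<bar><..}" "\<bar>a\<bar> + 1"]) (use a in auto)
  then show False using nz by simp
qed

text \<open>The continuous nonnegative square also has integral 0 over a compact interval around
  \<open>t\<close>, hence vanishes there.\<close>

lemma scalar_test_square_integral_0:
  assumes f: "f \<in> scalar_tests" and 0: "integral UNIV (\<lambda>t. f t * f t) = 0"
  shows "f t = 0"
proof -
  have int: "(\<lambda>t. f t * f t) integrable_on UNIV"
    by (intro scalar_tests_integrable scalar_tests_mult f scalar_tests_in_C_infinity[OF f])
  define b where "b = \<bar>t\<bar> + 1"
  have cont: "continuous_on {-b..b} (\<lambda>t. f t * f t)"
    by (intro continuous_intros C_infinity_continuous_on scalar_tests_in_C_infinity[OF f])
  have "integral {-b..b} (\<lambda>t. f t * f t) \<le> integral UNIV (\<lambda>t. f t * f t)"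
    by (intro integral_subset_le integrable_continuous_real cont int) auto
  moreover have "integral {-b..b} (\<lambda>t. f t * f t) \<ge> 0"
    by (intro integral_nonneg integrable_continuous_real cont) auto
  ultimately have "integral {-b..b} (\<lambda>t. f t * f t) = 0" using 0 by simp
  then have "\<forall>t\<in>{-b..b}. f t * f t = 0"
    using integral_eq_0_iff[OF cont] by (auto simp: b_def)
  moreover have "t \<in> {-b..b}" by (auto simp: b_def)
  ultimately show ?thesis by auto
qed

subsection \<open>Kernel representations and input cardinality\<close>

lemma C_infinity_component:
  fixes w :: "real \<Rightarrow> real ^ 'w::finite"
  assumes "w \<in> C_infinity"
  shows nth_vderiv_component: "nth_vderiv k (\<lambda>t. w t $ j) = (\<lambda>t. nth_vderiv k w t $ j)"
    and component_in_C_infinity: "(\<lambda>t. w t $ j) \<in> C_infinity"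
proof -
  have *: "((\<lambda>t. nth_vderiv k w t $ j) has_vector_derivative nth_vderiv (Suc k) w t $ j) (at t)" for k t
    by (rule bounded_linear.has_vector_derivative[OF bounded_linear_vec_nth
          C_infinity_has_vector_derivative[OF assms]])
  show "nth_vderiv k (\<lambda>t. w t $ j) = (\<lambda>t. nth_vderiv k w t $ j)"
    by (rule nth_vderiv_eqI[where G = "\<lambda>k t. nth_vderiv k w t $ j"]) (simp, rule *)
  show "(\<lambda>t. w t $ j) \<in> C_infinity"
    by (rule C_infinityI[where G = "\<lambda>k t. nth_vderiv k w t $ j"]) (simp, rule *)
qed

lemma C_infinity_vec_lambda:
  fixes f :: "'w::finite \<Rightarrow> real \<Rightarrow> real"
  assumes "\<And>j. f j \<in> C_infinity"
  shows "(\<lambda>t. \<chi> j. f j t) \<in> C_infinity"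
proof (rule C_infinityI[where G = "\<lambda>k t. \<chi> j. nth_vderiv k (f j) t"])
  fix k t
  show "((\<lambda>t. \<chi> j. nth_vderiv k (f j) t) has_vector_derivative
      (\<chi> j. nth_vderiv (Suc k) (f j) t)) (at t)"
    unfolding has_vector_derivative_def
  proof (subst has_derivative_componentwise_within, intro ballI)
    fix b :: "real ^ 'w" assume "b \<in> Basis"
    then obtain j where b: "b = axis j 1" by (auto simp: Basis_vec_def)
    have "(nth_vderiv k (f j) has_derivative (\<lambda>x. x *\<^sub>R nth_vderiv (Suc k) (f j) t)) (at t)"
      using C_infinity_has_vector_derivative[OF assms[of j], of k t]
      by (simp add: has_vector_derivative_def)
    then show "((\<lambda>x. (\<chi> j. nth_vderiv k (f j) x) \<bullet> b) has_derivative
        (\<lambda>x. x *\<^sub>R (\<chi> j. nth_vderiv (Suc k) (f j) t) \<bullet> b)) (at t)"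
      by (simp add: b inner_axis)
  qed
qed simp

lemma diff_op_eq_poly_diff:
  assumes "w \<in> C_infinity"
  shows "diff_op r w t = (\<Sum>j\<in>UNIV. poly_diff (r $ j) (\<lambda>t. w t $ j) t)"
  by (simp add: diff_op_def poly_diff_def nth_vderiv_component[OF assms])

lemma diff_op_add:
  "w \<in> C_infinity \<Longrightarrow> diff_op (r + s) w t = diff_op r w t + diff_op s w t"
  by (simp add: diff_op_eq_poly_diff poly_diff_add sum.distrib)

lemma diff_op_scale:
  assumes "w \<in> C_infinity"
  shows "diff_op (d *s r) w t = poly_diff d (diff_op r w) t"
proof -
  have eq: "diff_op r w = (\<lambda>t. \<Sum>j\<in>UNIV. 1 * poly_diff (r $ j) (\<lambda>t. w t $ j) t)"
    using diff_op_eq_poly_diff[OF assms] by auto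
  have "poly_diff d (diff_op r w) t = (\<Sum>j\<in>UNIV. 1 * poly_diff d (poly_diff (r $ j) (\<lambda>t. w t $ j)) t)"
    unfolding eq by (intro poly_diff_lincomb poly_diff_in_C_infinity component_in_C_infinity assms)
  then show ?thesis
    by (simp add: diff_op_eq_poly_diff assms poly_diff_mult component_in_C_infinity)
qed

lemma diff_op_in_C_infinity:
  assumes "w \<in> C_infinity"
  shows "diff_op r w \<in> C_infinity"
proof -
  have "diff_op r w = (\<lambda>t. \<Sum>j\<in>UNIV. 1 * poly_diff (r $ j) (\<lambda>t. w t $ j) t)"
    using diff_op_eq_poly_diff[OF assms] by auto
  moreover have "\<dots> \<in> C_infinity"
    by (intro C_infinity_lincomb poly_diff_in_C_infinity component_in_C_infinity assms)
  ultimately show ?thesis by simp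
qed

lemma diff_op_cong_open:
  assumes "open S" "\<And>t. t \<in> S \<Longrightarrow> v t = w t" "t \<in> S"
  shows "diff_op r v t = diff_op r w t"
  unfolding diff_op_def using nth_vderiv_cong_open[of S v w, OF assms] by simp

lemma diff_op_const_0: "diff_op r (\<lambda>t. 0) t = 0"
  by (simp add: diff_op_def nth_vderiv_const_0)

lemma zero_in_kernel_behavior: "(\<lambda>t. 0) \<in> kernel_behavior R"
  by (simp add: kernel_behavior_def C_infinity_0 diff_op_const_0)

section \<open>Signals generated by polynomial vectors\<close>

text \<open>The signal \<open>p(d/dt) f\<close>, driven by a free scalar function \<open>f\<close>
  as in an image representation.\<close>

definition image_signal :: "real poly ^ 'w::finite \<Rightarrow> (real \<Rightarrow> real) \<Rightarrow> real \<Rightarrow> real ^ 'w" where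
  "image_signal p f t = (\<chi> j. poly_diff (p $ j) f t)"

lemma image_signal_in_C_infinity: "f \<in> C_infinity \<Longrightarrow> image_signal p f \<in> C_infinity"
  unfolding image_signal_def[abs_def] by (intro C_infinity_vec_lambda poly_diff_in_C_infinity)

lemma diff_op_image_signal:
  assumes "f \<in> C_infinity"
  shows "diff_op r (image_signal p f) t = poly_diff (\<Sum>j\<in>UNIV. r $ j * p $ j) f t"
proof -
  have "(\<lambda>t. image_signal p f t $ j) = poly_diff (p $ j) f" for j
    by (auto simp: image_signal_def)
  then show ?thesis
    by (simp add: diff_op_eq_poly_diff image_signal_in_C_infinity assms poly_diff_sum poly_diff_mult)
qed

lemma image_signal_in_kernel_behavior:
  assumes "f \<in> C_infinity" "p \<in> annihilator (set R)"
  shows "image_signal p f \<in> kernel_behavior R"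
  using assms
  by (simp add: kernel_behavior_def image_signal_in_C_infinity diff_op_image_signal annihilator_def)

text \<open>Each component has its own support bound, and the maximum of these finitely many bounds
  serves for the whole vector.\<close>

lemma image_signal_in_test_functions:
  fixes p :: "real poly ^ 'w::finite"
  assumes f: "f \<in> scalar_tests"
  shows "image_signal p f \<in> test_functions"
proof -
  have "\<forall>j. \<exists>a. \<forall>t. \<bar>t\<bar> > a \<longrightarrow> poly_diff (p $ j) f t = 0"
    using poly_diff_scalar_tests[OF f] by (auto simp: scalar_tests_def)
  then obtain a where a: "\<And>j t. \<bar>t\<bar> > a j \<Longrightarrow> poly_diff (p $ j) f t = 0" by metis
  have "\<bar>t\<bar> \<le> Max (range a)" if "image_signal p f t \<noteq> 0" for t
  proof (rule ccontr)
    assume "\<not> \<bar>t\<bar> \<le> Max (range a)"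
    moreover have "a j \<le> Max (range a)" for j by (intro Max_ge) auto
    ultimately have "poly_diff (p $ j) f t = 0" for j using a by (meson not_le order.strict_trans1)
    with that show False by (simp add: image_signal_def vec_eq_iff)
  qed
  then have "bounded {t. image_signal p f t \<noteq> 0}" by (auto simp: bounded_iff)
  then show ?thesis
    using image_signal_in_C_infinity[OF scalar_tests_in_C_infinity[OF f]]
    by (simp add: test_functions_def compact_closure)
qed

text \<open>For \<open>p\<close> in the first annihilator, the signal driven by a nonzero test
  function lies in the larger behavior. For each row \<open>r\<close> of \<open>R'\<close>, the
  operator with polynomial \<open>r\<^sup>T p\<close> then annihilates that test function, so
  \<open>r\<^sup>T p\<close> is 0.\<close>

lemma annihilator_mono_kernel_behavior:
  assumes "kernel_behavior R \<subseteq> kernel_behavior R'"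
  shows "annihilator (set R) \<subseteq> annihilator (set R')"
proof
  fix p assume p: "p \<in> annihilator (set R)"
  obtain f t0 where f: "f \<in> scalar_tests" "f t0 \<noteq> 0" using scalar_tests_nontrivial by blast
  have "image_signal p f \<in> kernel_behavior R'"
    using image_signal_in_kernel_behavior[OF scalar_tests_in_C_infinity[OF f(1)] p] assms by blast
  then have "\<forall>r\<in>set R'. \<forall>t. poly_diff (\<Sum>j\<in>UNIV. r $ j * p $ j) f t = 0"
    by (simp add: kernel_behavior_def diff_op_image_signal scalar_tests_in_C_infinity[OF f(1)])
  then show "p \<in> annihilator (set R')"
    using poly_diff_scalar_test_eq_0[OF f] by (auto simp: annihilator_def)
qed

section \<open>Ranks and row spaces of kernel representations\<close>

lemma poly_matrix_rank_eq: "poly_matrix_rank R = vec.dim (fract_vec ` set R)"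
  by (simp add: poly_matrix_rank_def)

lemma poly_matrix_rank_add_dim_annihilator:
  fixes R :: "'w::finite poly_matrix"
  shows "poly_matrix_rank R + vec.dim (fract_vec ` annihilator (set R)) = CARD('w)"
  unfolding poly_matrix_rank_eq by (rule dim_add_dim_annihilator_fract)

text \<open>By the inclusion, the rows of \<open>R'\<close> add no condition to
  \<open>annihilator (set R)\<close>. Stacking both matrices thus keeps the rank of
  \<open>R\<close>, which is that of \<open>R'\<close>, so the stacked row space is already spanned
  by the rows of \<open>R'\<close>.\<close>

lemma row_span_eq_if_rank_eq:
  fixes R R' :: "'w::finite poly_matrix"
  assumes "kernel_behavior R \<subseteq> kernel_behavior R'" "poly_matrix_rank R = poly_matrix_rank R'"
    and "r \<in> set R"
  shows "fract_vec r \<in> vec.span (fract_vec ` set R')"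
proof -
  have "annihilator (set R \<union> set R') = annihilator (set R)"
    using annihilator_mono_kernel_behavior[OF assms(1)] by (auto simp: annihilator_def)
  then have "vec.dim (fract_vec ` (set R \<union> set R')) = vec.dim (fract_vec ` set R')"
    using dim_add_dim_annihilator_fract[of "set R \<union> set R'"]
      dim_add_dim_annihilator_fract[of "set R"] assms(2)
    by (simp add: poly_matrix_rank_eq)
  then have "vec.span (fract_vec ` set R') = vec.span (fract_vec ` (set R \<union> set R'))"
    by (intro vec.dim_eq_span) auto
  then show ?thesis using assms(3) by (simp add: vec.span_base)
qed

text \<open>A rational combination of rows becomes a polynomial consequence of them only after
  multiplication by some nonzero \<open>d\<close>. The result is an equation for
  \<open>r(d/dt) w\<close>, not yet its vanishing; controllability later bridges this gap.\<close>

lemma row_span_differential_consequence: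
  fixes R :: "'w::finite poly_matrix"
  assumes "fract_vec r \<in> vec.span (fract_vec ` set R)"
  obtains d where "d \<noteq> 0" "\<And>w t. w \<in> kernel_behavior R \<Longrightarrow> poly_diff d (diff_op r w) t = 0"
proof -
  \<comment> \<open>The set \<open>T\<close> collects the rational vectors with a polynomial
    multiple \<open>c\<close> whose equation holds on the behavior. It is a subspace containing the
    rows, hence contains their span.\<close>
  define T where "T = {x :: real poly fract ^ 'w. \<exists>d c. d \<noteq> 0 \<and> Fract d 1 *s x = fract_vec c \<and>
    (\<forall>w\<in>kernel_behavior R. diff_op c w = (\<lambda>t. 0))}"
  have smooth: "w \<in> C_infinity" if "w \<in> kernel_behavior R" for w
    using that by (simp add: kernel_behavior_def)
  have poly_diff_0: "poly_diff a (\<lambda>t. 0) t = 0" for a t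
    by (simp add: poly_diff_def nth_vderiv_const_0)
  have scale: "diff_op (a *s c) w = (\<lambda>t. 0)"
    if "diff_op c w = (\<lambda>t. 0)" "w \<in> kernel_behavior R" for a c w
    using that by (auto simp: diff_op_scale smooth poly_diff_0)
  have "vec.subspace T"
  proof (rule vec.subspaceI)
    show "0 \<in> T"
      unfolding T_def
      by (intro CollectI exI[of _ 1] exI[of _ 0])
        (auto simp: diff_op_def vec_eq_iff Zero_fract_def)
  next
    fix x y assume "x \<in> T" "y \<in> T"
    then obtain d c e b where x: "d \<noteq> 0" "Fract d 1 *s x = fract_vec c"
        "\<forall>w\<in>kernel_behavior R. diff_op c w = (\<lambda>t. 0)"
      and y: "e \<noteq> 0" "Fract e 1 *s y = fract_vec b"
        "\<forall>w\<in>kernel_behavior R. diff_op b w = (\<lambda>t. 0)"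
      unfolding T_def by auto
    have "Fract (d * e) 1 *s (x + y) = Fract e 1 *s (Fract d 1 *s x) + Fract d 1 *s (Fract e 1 *s y)"
      by (simp add: vec.scale_right_distrib mult.commute)
    also have "\<dots> = fract_vec (e *s c + d *s b)"
      unfolding x(2) y(2) by (simp add: vec_eq_iff)
    finally have "Fract (d * e) 1 *s (x + y) = fract_vec (e *s c + d *s b)" .
    moreover have "diff_op (e *s c + d *s b) w = (\<lambda>t. 0)" if "w \<in> kernel_behavior R" for w
      using scale[OF x(3)[rule_format, OF that] that] scale[OF y(3)[rule_format, OF that] that]
      by (auto simp: diff_op_add smooth[OF that])
    ultimately show "x + y \<in> T"
      unfolding T_def using x(1) y(1)
      by (intro CollectI exI[of _ "d * e"] exI[of _ "e *s c + d *s b"]) auto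
  next
    fix a :: "real poly fract" and x assume "x \<in> T"
    then obtain d c where x: "d \<noteq> 0" "Fract d 1 *s x = fract_vec c"
        "\<forall>w\<in>kernel_behavior R. diff_op c w = (\<lambda>t. 0)"
      unfolding T_def by auto
    obtain u v where a: "a = Fract u v" "v \<noteq> 0" by (cases a) auto
    have "Fract (d * v) 1 * a = Fract u 1 * Fract d 1"
      using a by (simp add: eq_fract)
    then have "Fract (d * v) 1 *s (a *s x) = Fract u 1 *s (Fract d 1 *s x)"
      by (simp only: vec.scale_scale)
    also have "\<dots> = fract_vec (u *s c)"
      unfolding x(2) by (simp add: vec_eq_iff)
    finally show "a *s x \<in> T"
      unfolding T_def using x a(2) scale
      by (intro CollectI exI[of _ "d * v"] exI[of _ "u *s c"]) auto
  qed
  moreover have "fract_vec ` set R \<subseteq> T"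
  proof
    fix x assume "x \<in> fract_vec ` set R"
    then obtain c where c: "c \<in> set R" "x = fract_vec c" by blast
    then show "x \<in> T"
      unfolding T_def
      by (intro CollectI exI[of _ 1] exI[of _ c]) (auto simp: vec_eq_iff kernel_behavior_def)
  qed
  ultimately have "fract_vec r \<in> T" using assms vec.span_minimal by blast
  then obtain d c where d: "d \<noteq> 0" "Fract d 1 *s fract_vec r = fract_vec c"
      "\<forall>w\<in>kernel_behavior R. diff_op c w = (\<lambda>t. 0)"
    unfolding T_def by blast
  have "c = d *s r" using d(2) by (simp add: vec_eq_iff)
  then have "poly_diff d (diff_op r w) t = 0" if "w \<in> kernel_behavior R" for w t
    using d(3) diff_op_scale[OF smooth[OF that], of d r t] that by auto
  then show ?thesis using d(1) that by blast
qed

lemma kernel_behavior_eq_if_rank_eq: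
  fixes R R' :: "'w::finite poly_matrix"
  assumes sub: "kernel_behavior R \<subseteq> kernel_behavior R'"
    and rank: "poly_matrix_rank R = poly_matrix_rank R'"
    and contr: "controllable (kernel_behavior R')"
  shows "kernel_behavior R = kernel_behavior R'"
proof (intro equalityI sub subsetI)
  fix w assume w: "w \<in> kernel_behavior R'"
  have smooth: "v \<in> C_infinity" if "v \<in> kernel_behavior R'" for v
    using that by (simp add: kernel_behavior_def)
  \<comment> \<open>The signal \<open>v\<close> steers rest to \<open>w\<close>. For a row \<open>r\<close> of \<open>R\<close>, a scalar equation annihilates
    \<open>r(d/dt) v\<close>, which vanishes in the past, hence everywhere; so \<open>r(d/dt) w\<close> vanishes in the
    future, hence everywhere by the same equation.\<close>
  obtain v \<tau> where v: "v \<in> kernel_behavior R'" "\<forall>t\<le>0. v t = 0" "\<forall>t\<ge>\<tau>. v t = w t"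
    using contr[unfolded controllable_def, rule_format, OF zero_in_kernel_behavior[of R'] w] by blast
  have "diff_op r w t = 0" if r: "r \<in> set R" for r t
  proof -
    obtain d where d: "d \<noteq> 0"
        "\<And>u t. u \<in> kernel_behavior R' \<Longrightarrow> poly_diff d (diff_op r u) t = 0"
      using row_span_differential_consequence[OF row_span_eq_if_rank_eq[OF sub rank r]] by blast
    have v_neg: "diff_op r v t = 0" if "t \<in> {..<0}" for t
      using diff_op_cong_open[of "{..<0}" v "\<lambda>t. 0" t r] that v(2) by (simp add: diff_op_const_0)
    have v0: "diff_op r v t = 0" for t
      by (rule poly_diff_unique[OF diff_op_in_C_infinity[OF smooth[OF v(1)]] d(1) d(2)[OF v(1)],
            of "{..<0}" "-1"]) (auto simp: v_neg)
    have w_pos: "diff_op r w t = 0" if "t \<in> {\<tau><..}" for t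
      using diff_op_cong_open[of "{\<tau><..}" w v t r] that v(3) v0 by simp
    show ?thesis
      by (rule poly_diff_unique[OF diff_op_in_C_infinity[OF smooth[OF w]] d(1) d(2)[OF w],
            of "{\<tau><..}" "\<tau> + 1"]) (auto simp: w_pos)
  qed
  then show "w \<in> kernel_behavior R" using smooth[OF w] by (simp add: kernel_behavior_def)
qed

section \<open>Orthogonality in terms of polynomial vectors\<close>

lemma pcompose_reflect_reflect: "pcompose (pcompose p [:0, -1:]) [:0, -1:] = (p :: real poly)"
  unfolding pcompose_assoc[symmetric] by (simp add: pcompose_pCons)

lemma smult_sum_right: "smult c (\<Sum>i\<in>A. p i) = (\<Sum>i\<in>A. smult c (p i))"
  by (induction A rule: infinite_finite_induct) (auto simp: smult_add_right)

text \<open>The row vector \<open>p(-\<xi>)\<^sup>T \<Sigma>\<close>; the sign change comes from integration by parts.\<close>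

definition adjoint_transform :: "real ^ 'w ^ 'w \<Rightarrow> real poly ^ 'w \<Rightarrow> real poly ^ 'w::finite" where
  "adjoint_transform \<Sigma> p = (\<chi> j. \<Sum>i\<in>UNIV. smult (\<Sigma> $ i $ j) (pcompose (p $ i) [:0, -1:]))"

text \<open>A right inverse of \<open>\<Sigma>\<close> recovers \<open>p(-\<xi>)\<close> from
  \<open>p(-\<xi>)\<^sup>T \<Sigma>\<close>, and the reflection is its own inverse.\<close>

lemma adjoint_transform_eq_0:
  assumes "invertible \<Sigma>" "adjoint_transform \<Sigma> p = 0"
  shows "p = 0"
proof -
  obtain M where M: "\<Sigma> ** M = mat 1" using assms(1) by (auto simp: invertible_def)
  have "p $ k = 0" for k
  proof -
    have "0 = (\<Sum>j\<in>UNIV. smult (M $ j $ k) (adjoint_transform \<Sigma> p $ j))"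
      using assms(2) by simp
    also have "\<dots> = (\<Sum>i\<in>UNIV. \<Sum>j\<in>UNIV. smult (\<Sigma> $ i $ j * M $ j $ k) (pcompose (p $ i) [:0, -1:]))"
      by (subst sum.swap) (simp add: adjoint_transform_def smult_sum_right mult.commute)
    also have "\<dots> = (\<Sum>i\<in>UNIV. smult ((\<Sigma> ** M) $ i $ k) (pcompose (p $ i) [:0, -1:]))"
      by (simp add: matrix_matrix_mult_def smult_sum)
    also have "\<dots> = (\<Sum>i\<in>UNIV. if i = k then pcompose (p $ i) [:0, -1:] else 0)"
      by (intro sum.cong) (auto simp: M mat_def)
    also have "\<dots> = pcompose (p $ k) [:0, -1:]" by simp
    finally have "pcompose (pcompose (p $ k) [:0, -1:]) [:0, -1:] = 0" by simp
    then show ?thesis by (simp only: pcompose_reflect_reflect)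
  qed
  then show ?thesis by (simp add: vec_eq_iff)
qed

text \<open>The transform is additive and injective but semilinear: a scalar \<open>c\<close> comes
  out as \<open>c(-\<xi>)\<close>.\<close>

lemma dim_adjoint_transform_image_ge:
  fixes \<Sigma> :: "real ^ 'w ^ 'w::finite"
  assumes "invertible \<Sigma>"
  shows "vec.dim (fract_vec ` P) \<le> vec.dim (fract_vec ` adjoint_transform \<Sigma> ` P)"
proof (rule dim_semilinear_image_ge[where \<sigma> = "\<lambda>c. pcompose c [:0, -1:]"])
  show "adjoint_transform \<Sigma> (p + q) = adjoint_transform \<Sigma> p + adjoint_transform \<Sigma> q" for p q
    by (simp add: adjoint_transform_def vec_eq_iff pcompose_add smult_add_right sum.distrib)
  show "adjoint_transform \<Sigma> (c *s p) = pcompose c [:0, -1:] *s adjoint_transform \<Sigma> p" for c p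
    by (simp add: adjoint_transform_def vec_eq_iff pcompose_mult sum_distrib_left)
  show "adjoint_transform \<Sigma> p = 0 \<Longrightarrow> p = 0" for p
    by (rule adjoint_transform_eq_0[OF assms])
  show "surj (\<lambda>c :: real poly. pcompose c [:0, -1:])"
    by (rule surjI[of _ "\<lambda>c. pcompose c [:0, -1:]"]) (rule pcompose_reflect_reflect)
qed simp

text \<open>Integration by parts moves the operators of \<open>p\<close> from \<open>f\<close> to
  the second signal, where they merge with \<open>\<Sigma>\<close> and \<open>q\<close> into one
  scalar operator acting on \<open>g\<close>.\<close>

lemma integral_image_signals:
  fixes \<Sigma> :: "real ^ 'w ^ 'w::finite"
  assumes f: "f \<in> scalar_tests" and g: "g \<in> scalar_tests"
  shows "integral UNIV (\<lambda>t. image_signal p f t \<bullet> (\<Sigma> *v image_signal q g t)) =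
    integral UNIV (\<lambda>t. f t * poly_diff (\<Sum>j\<in>UNIV. adjoint_transform \<Sigma> p $ j * q $ j) g t)"
proof -
  \<comment> \<open>Component \<open>i\<close> of \<open>\<Sigma> q(d/dt) g\<close>.\<close>
  define h where "h i t = (\<Sum>j\<in>UNIV. \<Sigma> $ i $ j * poly_diff (q $ j) g t)" for i t
  have gC: "g \<in> C_infinity" using g by (rule scalar_tests_in_C_infinity)
  have h: "h i \<in> C_infinity" for i
    unfolding h_def[abs_def] by (intro C_infinity_lincomb poly_diff_in_C_infinity gC)
  have int1: "(\<lambda>t. poly_diff (p $ i) f t * h i t) integrable_on UNIV" for i
    by (rule scalar_tests_integrable scalar_tests_mult poly_diff_scalar_tests f h)+
  have int2: "(\<lambda>t. f t * poly_diff (pcompose (p $ i) [:0, -1:]) (h i) t) integrable_on UNIV" for i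
    by (rule scalar_tests_integrable scalar_tests_mult poly_diff_in_C_infinity f h)+
  have "integral UNIV (\<lambda>t. image_signal p f t \<bullet> (\<Sigma> *v image_signal q g t)) =
      integral UNIV (\<lambda>t. \<Sum>i\<in>UNIV. poly_diff (p $ i) f t * h i t)"
    by (simp add: inner_vec_def image_signal_def matrix_vector_mult_def h_def)
  also have "\<dots> = (\<Sum>i\<in>UNIV. integral UNIV (\<lambda>t. poly_diff (p $ i) f t * h i t))"
    by (intro integral_sum int1) simp
  also have "\<dots> = (\<Sum>i\<in>UNIV. integral UNIV (\<lambda>t. f t * poly_diff (pcompose (p $ i) [:0, -1:]) (h i) t))"
    by (intro sum.cong refl poly_diff_adjoint f h)
  also have "\<dots> = integral UNIV (\<lambda>t. \<Sum>i\<in>UNIV. f t * poly_diff (pcompose (p $ i) [:0, -1:]) (h i) t)"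
    by (intro integral_sum[symmetric] int2) simp
  also have "(\<lambda>t. \<Sum>i\<in>UNIV. f t * poly_diff (pcompose (p $ i) [:0, -1:]) (h i) t) =
      (\<lambda>t. f t * poly_diff (\<Sum>j\<in>UNIV. adjoint_transform \<Sigma> p $ j * q $ j) g t)"
  proof
    fix t
    have "poly_diff (pcompose (p $ i) [:0, -1:]) (h i) t =
        (\<Sum>j\<in>UNIV. \<Sigma> $ i $ j * poly_diff (pcompose (p $ i) [:0, -1:] * q $ j) g t)" for i
      unfolding h_def[abs_def] poly_diff_mult[OF gC]
      by (intro poly_diff_lincomb poly_diff_in_C_infinity gC)
    then have "(\<Sum>i\<in>UNIV. poly_diff (pcompose (p $ i) [:0, -1:]) (h i) t) =
        (\<Sum>i\<in>UNIV. \<Sum>j\<in>UNIV. \<Sigma> $ i $ j * poly_diff (pcompose (p $ i) [:0, -1:] * q $ j) g t)"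
      by simp
    also have "\<dots> =
        (\<Sum>j\<in>UNIV. \<Sum>i\<in>UNIV. \<Sigma> $ i $ j * poly_diff (pcompose (p $ i) [:0, -1:] * q $ j) g t)"
      by (rule sum.swap)
    also have "\<dots> = poly_diff (\<Sum>j\<in>UNIV. adjoint_transform \<Sigma> p $ j * q $ j) g t"
      by (simp add: adjoint_transform_def sum_distrib_right poly_diff_sum poly_diff_smult)
    finally show "(\<Sum>i\<in>UNIV. f t * poly_diff (pcompose (p $ i) [:0, -1:]) (h i) t) =
        f t * poly_diff (\<Sum>j\<in>UNIV. adjoint_transform \<Sigma> p $ j * q $ j) g t"
      by (simp flip: sum_distrib_left)
  qed
  finally show ?thesis .
qed

lemma dim_annihilators_le_if_orthogonal:
  fixes \<Sigma> :: "real ^ 'w ^ 'w::finite" and R1 R2 :: "'w poly_matrix"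
  assumes inv: "invertible \<Sigma>"
    and orth: "\<And>w1 w2. w1 \<in> kernel_behavior R1 \<inter> test_functions \<Longrightarrow>
      w2 \<in> kernel_behavior R2 \<inter> test_functions \<Longrightarrow> integral UNIV (\<lambda>t. w1 t \<bullet> (\<Sigma> *v w2 t)) = 0"
  shows "vec.dim (fract_vec ` annihilator (set R1)) + vec.dim (fract_vec ` annihilator (set R2))
    \<le> CARD('w)"
proof -
  let ?A = "adjoint_transform \<Sigma> ` annihilator (set R1)"
  have "(\<Sum>j\<in>UNIV. adjoint_transform \<Sigma> p $ j * q $ j) = 0" (is "?s = 0")
    if p: "p \<in> annihilator (set R1)" and q: "q \<in> annihilator (set R2)" for p q
  proof -
    obtain g t0 where g: "g \<in> scalar_tests" "g t0 \<noteq> 0" using scalar_tests_nontrivial by blast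
    \<comment> \<open>Testing orthogonality against \<open>s(d/dt) g\<close> itself turns the integral into a square.\<close>
    let ?f = "poly_diff ?s g"
    have f: "?f \<in> scalar_tests" using g(1) by (rule poly_diff_scalar_tests)
    have "integral UNIV (\<lambda>t. ?f t * ?f t) =
        integral UNIV (\<lambda>t. image_signal p ?f t \<bullet> (\<Sigma> *v image_signal q g t))"
      by (rule integral_image_signals[OF f g(1), symmetric])
    also have "\<dots> = 0"
      using f g(1) p q by (intro orth IntI image_signal_in_kernel_behavior
          image_signal_in_test_functions scalar_tests_in_C_infinity)
    finally have "?f t = 0" for t by (rule scalar_test_square_integral_0[OF f])
    then show ?thesis by (rule poly_diff_scalar_test_eq_0[OF g])
  qed
  \<comment> \<open>The vectors of \<open>?A\<close> and of \<open>annihilator (set R2)\<close> are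
    orthogonal. As the transform does not lower the dimension, rank-nullity for \<open>?A\<close>
    bounds the sum of the two dimensions.\<close>
  then have "annihilator (set R2) \<subseteq> annihilator ?A" by (auto simp: annihilator_def)
  then have "vec.dim (fract_vec ` annihilator (set R2)) \<le> vec.dim (fract_vec ` annihilator ?A)"
    by (intro vec.dim_subset image_mono)
  moreover have "vec.dim (fract_vec ` annihilator (set R1)) \<le> vec.dim (fract_vec ` ?A)"
    by (rule dim_adjoint_transform_image_ge[OF inv])
  ultimately show ?thesis using dim_add_dim_annihilator_fract[of ?A] by linarith
qed

section \<open>Comparison of input cardinalities\<close>

text \<open>The representation obtained is the very one that the choice in \<open>input_card\<close>
  selects; rank-nullity shows that the subtraction there is not truncated.\<close>

lemma input_card_representation:
  fixes B :: "(real \<Rightarrow> real ^ 'w::finite) set"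
  assumes "B \<in> behaviors"
  obtains R where "B = kernel_behavior R" "input_card B + poly_matrix_rank R = CARD('w)"
proof -
  define R where "R = (SOME R. B = kernel_behavior R)"
  have "B = kernel_behavior R"
    unfolding R_def by (rule someI_ex) (use assms in \<open>auto simp: behaviors_def\<close>)
  moreover have "input_card B + poly_matrix_rank R = CARD('w)"
    using poly_matrix_rank_add_dim_annihilator[of R] by (simp add: input_card_def R_def)
  ultimately show ?thesis by (rule that)
qed

text \<open>Inclusion enlarges the annihilator, whose dimension is the input cardinality. In the
  strict case, equal cardinalities would mean equal ranks and hence \<open>B = B'\<close>, although
  only one of them is controllable.\<close>

lemma input_card_mono:
  assumes "B \<in> behaviors" "B' \<in> behaviors" "B \<subseteq> B'"
  shows "input_card B \<le> input_card B'"
    and "controllable B' \<Longrightarrow> \<not> controllable B \<Longrightarrow> input_card B < input_card B'"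
proof -
  obtain R where R: "B = kernel_behavior R" "input_card B + poly_matrix_rank R = CARD('a)"
    using assms(1) by (rule input_card_representation)
  obtain R' where R': "B' = kernel_behavior R'" "input_card B' + poly_matrix_rank R' = CARD('a)"
    using assms(2) by (rule input_card_representation)
  have "vec.dim (fract_vec ` annihilator (set R)) \<le> vec.dim (fract_vec ` annihilator (set R'))"
    using assms(3) R(1) R'(1)
    by (intro vec.dim_subset image_mono annihilator_mono_kernel_behavior) simp
  then show le: "input_card B \<le> input_card B'"
    using poly_matrix_rank_add_dim_annihilator[of R] poly_matrix_rank_add_dim_annihilator[of R']
      R(2) R'(2) by linarith
  show "input_card B < input_card B'" if "controllable B'" "\<not> controllable B"
  proof (rule ccontr)
    assume "\<not> input_card B < input_card B'"
    then have "poly_matrix_rank R = poly_matrix_rank R'" using le R(2) R'(2) by linarith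
    then have "B = B'"
      using kernel_behavior_eq_if_rank_eq assms(3) that(1) unfolding R(1) R'(1) by blast
    with that show False by simp
  qed
qed

theorem lemma8p6:
  fixes B1 B2 :: "(real \<Rightarrow> real ^ 'w) set" and \<Sigma> :: "real ^ 'w ^ 'w"
  assumes "B1 \<in> behaviors" and "B2 \<in> behaviors"
    and "\<not> controllable B1 \<or> \<not> controllable B2"
    and "invertible \<Sigma>"
    and "orthogonal_behaviors \<Sigma> B1 B2"
  shows "input_card B1 + input_card B2 < CARD('w)"
proof -
  obtain C1 C2 where C: "C1 \<in> behaviors" "controllable C1" "C2 \<in> behaviors" "controllable C2"
      "B1 \<subseteq> C1" "B2 \<subseteq> C2"
    and orth: "\<forall>w1\<in>C1 \<inter> test_functions. \<forall>w2\<in>C2 \<inter> test_functions.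
        integral UNIV (\<lambda>t. w1 t \<bullet> (\<Sigma> *v w2 t)) = 0"
    using assms(5) unfolding orthogonal_behaviors_def controllable_behaviors_def by blast
  obtain R1 where R1: "C1 = kernel_behavior R1" "input_card C1 + poly_matrix_rank R1 = CARD('w)"
    using C(1) by (rule input_card_representation)
  obtain R2 where R2: "C2 = kernel_behavior R2" "input_card C2 + poly_matrix_rank R2 = CARD('w)"
    using C(3) by (rule input_card_representation)
  have "vec.dim (fract_vec ` annihilator (set R1)) + vec.dim (fract_vec ` annihilator (set R2))
      \<le> CARD('w)"
    using orth unfolding R1(1) R2(1)
    by (intro dim_annihilators_le_if_orthogonal[OF assms(4)]) blast
  then have "input_card C1 + input_card C2 \<le> CARD('w)"
    using poly_matrix_rank_add_dim_annihilator[of R1] poly_matrix_rank_add_dim_annihilator[of R2]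
      R1(2) R2(2) by linarith
  \<comment> \<open>Passing to the controllable behaviors \<open>C1\<close> and \<open>C2\<close>
    never lowers the input cardinality and raises it strictly for an uncontrollable
    \<open>B1\<close> or \<open>B2\<close>, which makes the bound strict.\<close>
  moreover note input_card_mono[OF assms(1) C(1) C(5)] input_card_mono[OF assms(2) C(3) C(6)]
  ultimately show ?thesis using assms(3) C(2,4) by linarith
qed

end
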